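(* For positive integers $k$ and $m_1,\dots,m_{k+1}$, with $M=m_1+\cdots+m_{k+1}$, \begin{align*} &\zeta\left(\overline{1},\{1\}_{m_1-1},2,\{1\}_{m_2-1},2,\ldots,\{1\}_{m_k-1},2,\{1\}_{m_{k+1}-1}\right)\\ &=\sum_{\sigma_1,\dots,\sigma_k\in\{\pm1\}}\frac{\mathrm{Li}_{\{1\}_{M+k}}\left(-1,\{1\}_{m_{k+1}-1},\sigma_1,\sigma_1,\{1\}_{m_k-1},\sigma_2,\sigma_2,\ldots,\{1\}_{m_2-1},\sigma_k,\sigma_k,\{1\}_{m_1-1}\right)}{(-1)^k\sigma_1\sigma_2\cdots\sigma_k}. \end{align*}
   Context: Alternating MZVs: for nonzero integers $s_j$ (overlined $\overline{s}$ means $-s$), $\zeta(s_1,\dots,s_k)=\sum_{n_1>\cdots>n_k\ge1}\prod_j\mathrm{sgn}(s_j)^{n_j}n_j^{-|s_j|}$. Multiple polylogarithm: $\mathrm{Li}_{s_1,\dots,s_r}(z_1,\dots,z_r)=\sum_{n_1>\cdots>n_r\ge1}\frac{z_1^{n_1}\cdots z_r^{n_r}}{n_1^{s_1}\cdots n_r^{s_r}}$. $\{1\}_d$ denotes $d$ consecutive entries (arguments) equal to $1$, empty if $d=0$. *)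

theory Defs
  imports "HOL-Analysis.Analysis"
begin

definition strict_index_lists :: "nat \<Rightarrow> nat \<Rightarrow> nat list set" where
  "strict_index_lists r N =
     {ns. length ns = r \<and> sorted_wrt (>) ns \<and> set ns \<subseteq> {1..N}}"

(* The nested series of interest may converge only conditionally (leading entry with |s| = 1),
   so, as usual, their value is the limit of the partial sums over N >= n_1 > ... > n_r >= 1. *)

definition alt_mzv_partial :: "int list \<Rightarrow> nat \<Rightarrow> real" where
  "alt_mzv_partial ss N =
     (\<Sum>ns\<in>strict_index_lists (length ss) N.
        \<Prod>j<length ss. of_int (sgn (ss ! j)) ^ (ns ! j) / real (ns ! j) ^ nat \<bar>ss ! j\<bar>)"

definition alt_mzv :: "int list \<Rightarrow> real" where
  "alt_mzv ss = lim (alt_mzv_partial ss)"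

definition multi_polylog_partial :: "nat list \<Rightarrow> complex list \<Rightarrow> nat \<Rightarrow> complex" where
  "multi_polylog_partial ss zs N =
     (\<Sum>ns\<in>strict_index_lists (length ss) N.
        \<Prod>j<length ss. (zs ! j) ^ (ns ! j) / of_nat (ns ! j) ^ (ss ! j))"

definition multi_polylog :: "nat list \<Rightarrow> complex list \<Rightarrow> complex" where
  "multi_polylog ss zs = lim (multi_polylog_partial ss zs)"

end

theory Submission
  imports Defs
begin

text \<open>
  The alternating zeta value is the iterated integral from \<open>0\<close> to \<open>-1\<close> of the word
  \<open>x1^m1 x0 x1^m2 x0 \<dots> x0 x1^m(k+1)\<close> in the forms \<open>x0 = dz / z\<close> and \<open>x1 = dz / (1 - z)\<close>. The
  involution \<open>z \<mapsto> - (1 + z) / (1 - z)\<close> swaps the end points, so it reverses the word; with the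
  reversal of orientation it fixes \<open>x1\<close> and turns \<open>x0\<close> into \<open>- dz / (1 + z) - dz / (1 - z)\<close>.
  Each of the \<open>k\<close> letters \<open>x0\<close> thus splits into two terms, indexed by a sign, and the resulting
  words are the polylogarithms on the right-hand side.
  All integrals are handled through their Taylor coefficients at \<open>0\<close>; Abel's limit theorem
  passes to the end point.
\<close>

section \<open>Nested sums as iterated operators\<close>

text \<open>Entry \<open>n\<close> collects the terms whose largest index is \<open>n\<close>, so
  one application puts a new outermost index in front of a nested sum.\<close>

definition nest :: "(nat \<Rightarrow> 'a::comm_semiring_1) \<Rightarrow> (nat \<Rightarrow> 'a) \<Rightarrow> nat \<Rightarrow> 'a" where
  "nest g s n = g n * (\<Sum>i<n. s i)"

text \<open>The coefficients of the constant function 1, standing for the empty index tuple. The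
  mass sits at 0, so the innermost summation index is automatically at least 1.\<close>

definition unit_seq :: "nat \<Rightarrow> 'a::zero_neq_one" where
  "unit_seq n = (if n = 0 then 1 else 0)"

lemma strict_index_lists_0: "strict_index_lists 0 N = {[]}"
  by (auto simp: strict_index_lists_def)

lemma finite_strict_index_lists: "finite (strict_index_lists r N)"
proof (rule finite_subset)
  show "strict_index_lists r N \<subseteq> {ns. set ns \<subseteq> {1..N} \<and> length ns = r}"
    by (auto simp: strict_index_lists_def)
qed (simp add: finite_lists_length_eq)

lemma strict_index_lists_Suc:
  "strict_index_lists (Suc r) N =
     (\<lambda>(n, ns). n # ns) ` (SIGMA n:{1..N}. strict_index_lists r (n - 1))"
proof (intro set_eqI iffI)
  fix ns assume "ns \<in> strict_index_lists (Suc r) N"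
  then obtain n ns' where "ns = n # ns'" "length ns' = r" "sorted_wrt (>) ns'"
    "\<forall>x\<in>set ns'. x < n" "n \<in> {1..N}" "set ns' \<subseteq> {1..N}"
    by (cases ns) (auto simp: strict_index_lists_def)
  moreover from this have "ns' \<in> strict_index_lists r (n - 1)"
    by (fastforce simp: strict_index_lists_def)
  ultimately show "ns \<in> (\<lambda>(n, ns). n # ns) ` (SIGMA n:{1..N}. strict_index_lists r (n - 1))"
    by force
next
  fix ns assume "ns \<in> (\<lambda>(n, ns). n # ns) ` (SIGMA n:{1..N}. strict_index_lists r (n - 1))"
  then show "ns \<in> strict_index_lists (Suc r) N"
    by (fastforce simp: strict_index_lists_def)
qed

text \<open>Splitting off the largest index \<open>n\<close> leaves tuples bounded by
  \<open>n - 1\<close>, which is the inner sum in \<open>nest\<close>.\<close>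

lemma sum_strict_index_lists:
  fixes gs :: "(nat \<Rightarrow> 'a::comm_ring_1) list"
  shows "(\<Sum>ns\<in>strict_index_lists (length gs) N. \<Prod>j<length gs. (gs ! j) (ns ! j)) =
         (\<Sum>n\<le>N. foldr nest gs unit_seq n)"
proof (induction gs arbitrary: N)
  case Nil
  then show ?case
    by (simp add: strict_index_lists_0 unit_seq_def)
next
  case (Cons g gs)
  let ?f = "\<lambda>ns. \<Prod>j<length gs. (gs ! j) (ns ! j)"
  have "(\<Sum>ns\<in>strict_index_lists (length (g # gs)) N.
          \<Prod>j<length (g # gs). ((g # gs) ! j) (ns ! j))
      = (\<Sum>(n, ns)\<in>(SIGMA n:{1..N}. strict_index_lists (length gs) (n - 1)). g n * ?f ns)"
    by (simp add: strict_index_lists_Suc sum.reindex inj_on_def prod.lessThan_Suc_shift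
        case_prod_unfold del: prod.lessThan_Suc)
  also have "\<dots> = (\<Sum>n\<in>{1..N}. g n * (\<Sum>i\<le>n - 1. foldr nest gs unit_seq i))"
    by (subst sum.Sigma [symmetric])
      (simp_all add: finite_strict_index_lists sum_distrib_left [symmetric] Cons.IH)
  also have "\<dots> = (\<Sum>n\<in>{1..N}. nest g (foldr nest gs unit_seq) n)"
  proof (rule sum.cong [OF refl])
    fix n assume "n \<in> {1..N}"
    then have "{..n - 1} = {..<n}" by auto
    then show "g n * (\<Sum>i\<le>n - 1. foldr nest gs unit_seq i) = nest g (foldr nest gs unit_seq) n"
      by (simp add: nest_def)
  qed
  \<comment> \<open>The added term \<open>n = 0\<close> vanishes because its inner sum is
    empty.\<close>
  also have "\<dots> = (\<Sum>n\<le>N. nest g (foldr nest gs unit_seq) n)"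
    by (rule sum.mono_neutral_left) (auto simp: nest_def not_less_eq_eq)
  finally show ?case by simp
qed


section \<open>Sequences decaying like an inverse square root\<close>

text \<open>The sequences that occur are bounded by powers of log n over n. The weaker rate 1/sqrt n
  absorbs the logarithms, is reproduced by averaging, and still suffices for convergence at
  -1.\<close>

definition sqrt_decay :: "(nat \<Rightarrow> 'a::real_normed_vector) \<Rightarrow> bool" where
  "sqrt_decay s \<longleftrightarrow> (\<exists>C. \<forall>n. norm (s n) \<le> C / sqrt (real (Suc n)))"

lemma sqrt_decayE:
  assumes "sqrt_decay s"
  obtains C where "C \<ge> 0" "\<And>n. norm (s n) \<le> C / sqrt (real (Suc n))"
proof -
  from assms obtain C where C: "\<And>n. norm (s n) \<le> C / sqrt (real (Suc n))"
    by (auto simp: sqrt_decay_def)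
  have "0 \<le> norm (s 0)" by simp
  also have "\<dots> \<le> C" using C[of 0] by simp
  finally show ?thesis using C that by blast
qed

lemma sqrt_decay_unit_seq: "sqrt_decay (unit_seq :: nat \<Rightarrow> 'a::real_normed_field)"
  unfolding sqrt_decay_def by (intro exI[of _ 1]) (auto simp: unit_seq_def)

lemma sqrt_decay_le:
  assumes "sqrt_decay s" "\<And>n. norm (t n) \<le> norm (s n)"
  shows "sqrt_decay t"
  using assms unfolding sqrt_decay_def by (meson order_trans)

lemma sqrt_decay_tendsto_0:
  assumes "sqrt_decay s"
  shows "s \<longlonglongrightarrow> 0"
proof -
  obtain C where C: "\<And>n. norm (s n) \<le> C / sqrt (real (Suc n))"
    using sqrt_decayE[OF assms] by blast
  have "filterlim (\<lambda>n. sqrt (real (Suc n))) at_top sequentially"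
    by (intro filterlim_compose[OF sqrt_at_top]
        filterlim_compose[OF filterlim_real_sequentially filterlim_Suc])
  then have "(\<lambda>n. C / sqrt (real (Suc n))) \<longlonglongrightarrow> 0"
    by (intro tendsto_divide_0[OF tendsto_const] filterlim_at_top_imp_at_infinity)
  then show ?thesis
    by (rule Lim_null_comparison[rotated]) (simp add: C del: of_nat_Suc)
qed

lemma sqrt_decay_Bseq: "sqrt_decay s \<Longrightarrow> Bseq s"
  using sqrt_decay_tendsto_0 convergent_imp_Bseq convergentI by blast

lemma sum_inverse_sqrt_le: "(\<Sum>i<n. 1 / sqrt (real (Suc i))) \<le> 2 * sqrt (real n)"
proof (induction n)
  case (Suc n)
  have "1 / sqrt (real (Suc n)) \<le> 2 * sqrt (real (Suc n)) - 2 * sqrt (real n)"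
  proof -
    define a b where "a = sqrt (real n)" and "b = sqrt (real (Suc n))"
    have ab: "a \<ge> 0" "b > 0" "a \<le> b" "b * b = a * a + 1"
      by (auto simp: a_def b_def)
    \<comment> \<open>With b^2 = a^2 + 1 this square gives 1 <= 2b(b - a), the telescoping bound for
      one term.\<close>
    have "(b - a) * (b - a) \<ge> 0" by simp
    then have "1 \<le> (2 * b - 2 * a) * b"
      using ab by (simp add: algebra_simps)
    then show ?thesis
      unfolding a_def[symmetric] b_def[symmetric] using ab by (simp add: pos_divide_le_eq)
  qed
  with Suc show ?case by simp
qed simp

text \<open>Summing \<open>n\<close> terms of size 1/sqrt i gives order sqrt n, and dividing by
  \<open>n\<close> restores the rate 1/sqrt n.\<close>

lemma sqrt_decay_averaging:
  fixes s t :: "nat \<Rightarrow> 'a::real_normed_field"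
  assumes "sqrt_decay s" and K: "K \<ge> 0"
    and t: "\<And>n. norm (t n) \<le> K / real n * (\<Sum>i<n. norm (s i))"
  shows "sqrt_decay t"
proof -
  obtain C where C: "C \<ge> 0" "\<And>n. norm (s n) \<le> C / sqrt (real (Suc n))"
    using sqrt_decayE[OF assms(1)] by blast
  have "norm (t n) \<le> 4 * K * C / sqrt (real (Suc n))" for n
  proof (cases "n = 0")
    case True
    then show ?thesis using t[of 0] C K by simp
  next
    case False
    have "(\<Sum>i<n. norm (s i)) \<le> (\<Sum>i<n. C * (1 / sqrt (real (Suc i))))"
      by (intro sum_mono) (use C in simp)
    also have "\<dots> \<le> C * (2 * sqrt (real n))"
      unfolding sum_distrib_left[symmetric]
      by (intro mult_left_mono sum_inverse_sqrt_le C)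
    finally have "norm (t n) \<le> K / real n * (C * (2 * sqrt (real n)))"
      using t[of n] K by (meson mult_left_mono divide_nonneg_nonneg of_nat_0_le_iff order_trans)
    also have "\<dots> = 2 * K * C / sqrt (real n)"
      using False by (simp add: field_simps real_sqrt_mult_self flip: real_sqrt_mult)
    \<comment> \<open>The factor 4 serves to replace \<open>n\<close> by \<open>Suc n\<close>, since
      \<open>Suc n\<close> <= 4n for n >= 1.\<close>
    also have "\<dots> = 4 * K * C / sqrt (real (4 * n))"
      by (simp add: real_sqrt_mult)
    also have "\<dots> \<le> 4 * K * C / sqrt (real (Suc n))"
      using False K C by (intro divide_left_mono) auto
    finally show ?thesis .
  qed
  then show ?thesis unfolding sqrt_decay_def by blast
qed

lemma sqrt_decay_nest:
  fixes s :: "nat \<Rightarrow> 'a::real_normed_field"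
  assumes "sqrt_decay s" and g: "\<And>n. norm (g n) \<le> 1 / real n"
  shows "sqrt_decay (nest g s)"
proof (rule sqrt_decay_averaging[OF assms(1), of 1])
  show "norm (nest g s n) \<le> 1 / real n * (\<Sum>i<n. norm (s i))" for n
    unfolding nest_def norm_mult by (intro mult_mono g norm_sum) auto
qed simp

text \<open>The averages \<open>u\<close> vary slowly: consecutive differences are of order
  n^(-3/2), so their alternating series converges absolutely. Summation by parts transfers
  convergence to the series of \<open>u\<close>, without any monotonicity.\<close>

lemma summable_alternating:
  fixes s :: "nat \<Rightarrow> 'a::{real_normed_field,banach}"
  assumes "sqrt_decay s"
  shows "summable (\<lambda>n. (-1) ^ n * nest (\<lambda>n. 1 / of_nat n) s n)"
proof -
  define u where "u = nest (\<lambda>n. 1 / of_nat n) s"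
  have u: "sqrt_decay u"
    unfolding u_def by (rule sqrt_decay_nest[OF assms]) (simp add: norm_divide)
  obtain C where C: "C \<ge> 0" "\<And>n. norm (s n) \<le> C / sqrt (real (Suc n))"
    using sqrt_decayE[OF assms(1)] by blast
  obtain D where D: "D \<ge> 0" "\<And>n. norm (u n) \<le> D / sqrt (real (Suc n))"
    using sqrt_decayE[OF u] by blast
  \<comment> \<open>This is the recurrence (n+1) u(n+1) = n u(n) + s(n) of running averages.\<close>
  have diff: "u n - u (Suc n) = (u n - s n) / of_nat (Suc n)" for n
  proof -
    have "of_nat (Suc n) * u (Suc n) = of_nat n * u n + s n"
      by (cases "n = 0") (simp_all add: u_def nest_def divide_simps del: of_nat_Suc)
    then show ?thesis
      by (simp add: field_simps del: of_nat_Suc) (simp add: algebra_simps)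
  qed
  have "summable (\<lambda>n. (C + D) * real (Suc n) powr (-3/2))"
    using summable_real_powr_iff[of "-3/2"] summable_Suc_iff[of "\<lambda>n. real n powr (-3/2)"]
    by (intro summable_mult) simp
  moreover have "norm ((-1) ^ n * (u n - u (Suc n))) \<le> (C + D) * real (Suc n) powr (-3/2)" for n
  proof -
    have "norm ((-1) ^ n * (u n - u (Suc n))) = norm (u n - s n) / real (Suc n)"
      by (simp add: diff norm_mult norm_divide norm_power del: of_nat_Suc)
    also have "\<dots> \<le> (D / sqrt (real (Suc n)) + C / sqrt (real (Suc n))) / real (Suc n)"
      by (intro divide_right_mono order_trans[OF norm_triangle_ineq4] add_mono C D) auto
    also have "\<dots> = (C + D) * (real (Suc n) powr (-1/2) * real (Suc n) powr (-1))"
      by (simp add: powr_minus powr_half_sqrt field_simps del: of_nat_Suc)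
    also have "\<dots> = (C + D) * real (Suc n) powr (-3/2)"
      unfolding powr_add[symmetric] by simp
    finally show ?thesis .
  qed
  ultimately have "summable (\<lambda>n. (-1) ^ n * (u n - u (Suc n)))"
    by (rule summable_comparison_test'[where N = 0])
  then obtain l where l: "(\<lambda>N. \<Sum>n<N. (-1) ^ n * (u n - u (Suc n))) \<longlonglongrightarrow> l"
    by (auto simp: summable_iff_convergent convergent_def)
  have "(\<lambda>N. (-1) ^ N * u N) \<longlonglongrightarrow> 0"
    using sqrt_decay_tendsto_0[OF u] by (subst tendsto_norm_zero_iff[symmetric])
      (simp add: norm_mult norm_power tendsto_norm_zero)
  with l have "(\<lambda>N. ((\<Sum>n<N. (-1) ^ n * (u n - u (Suc n))) - (-1) ^ N * u N) / 2)
      \<longlonglongrightarrow> (l - 0) / 2"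
    by (intro tendsto_intros) auto
  \<comment> \<open>Summation by parts; the boundary term at 0 is absent because
    \<open>u 0 = 0\<close>.\<close>
  moreover have "((\<Sum>n<N. (-1) ^ n * (u n - u (Suc n))) - (-1) ^ N * u N) / 2
      = (\<Sum>n<N. (-1) ^ n * u n)" for N
    by (induction N) (simp add: u_def nest_def, simp add: field_simps)
  ultimately show ?thesis
    by (auto simp: summable_iff_convergent u_def convergent_def)
qed


section \<open>Power series with bounded coefficients\<close>

definition gf :: "(nat \<Rightarrow> real) \<Rightarrow> real \<Rightarrow> real" where
  "gf s z = (\<Sum>n. s n * z ^ n)"

lemma summable_bounded_powser:
  fixes s :: "nat \<Rightarrow> real"
  assumes "Bseq s" "\<bar>z\<bar> < 1"
  shows "summable (\<lambda>n. s n * z ^ n)"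
proof -
  obtain K where K: "\<And>n. norm (s n) \<le> K"
    using assms(1) by (auto simp: Bseq_def)
  show ?thesis
  proof (rule summable_comparison_test')
    show "summable (\<lambda>n. K * \<bar>z\<bar> ^ n)"
      using assms(2) by (intro summable_mult summable_geometric) simp
    show "norm (s n * z ^ n) \<le> K * \<bar>z\<bar> ^ n" for n
      using K[of n] by (simp add: abs_mult power_abs mult_right_mono)
  qed
qed

lemma has_derivative_gf:
  assumes "Bseq s" "\<bar>z\<bar> < 1"
  shows "(gf s has_real_derivative gf (diffs s) z) (at z)"
  unfolding gf_def using assms
  by (intro termdiffs_strong'[where K = 1] summable_bounded_powser) auto

lemma summable_diffs:
  fixes s :: "nat \<Rightarrow> real"
  assumes "Bseq s" "\<bar>z\<bar> < 1"
  shows "summable (\<lambda>n. diffs s n * z ^ n)"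
  using assms by (intro termdiff_converges[where K = 1] summable_bounded_powser) auto

text \<open>Partial sums are the coefficients of a product with 1/(1 - z), so averaging is
  integration against the form \<open>x1\<close>.\<close>

lemma diffs_averages:
  "diffs (nest (\<lambda>n. 1 / real n) s) = (\<lambda>n. \<Sum>i\<le>n. s i)"
  by (auto simp: diffs_def nest_def lessThan_Suc_atMost simp del: of_nat_Suc)

lemma Bseq_averages:
  fixes s :: "nat \<Rightarrow> real"
  assumes "Bseq s"
  shows "Bseq (nest (\<lambda>n. 1 / real n) s)"
proof -
  obtain K where K: "K > 0" "\<And>n. norm (s n) \<le> K"
    using assms by (auto simp: Bseq_def)
  have "norm (nest (\<lambda>n. 1 / real n) s n) \<le> K" for n
  proof (cases "n = 0")
    case False
    have "\<bar>\<Sum>i<n. s i\<bar> \<le> real n * K"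
      using sum_norm_le[of "{..<n}" s "\<lambda>_. K"] K by simp
    with False show ?thesis by (simp add: nest_def abs_mult field_simps)
  qed (use K in \<open>simp add: nest_def\<close>)
  then show ?thesis by (rule BseqI'[of _ K])
qed

text \<open>Partial sums of a bounded sequence may grow, so convergence is taken from the derivative
  of the series of averages. The identity comes from shifting the index by one.\<close>

lemma gf_partial_sums:
  assumes "Bseq s" "\<bar>z\<bar> < 1"
  shows "summable (\<lambda>n. (\<Sum>i\<le>n. s i) * z ^ n)"
    and "(1 - z) * gf (\<lambda>n. \<Sum>i\<le>n. s i) z = gf s z"
proof -
  let ?S = "\<lambda>n. \<Sum>i\<le>n. s i"
  show S: "summable (\<lambda>n. ?S n * z ^ n)"
    using summable_diffs[OF Bseq_averages[OF assms(1)] assms(2)] by (simp add: diffs_averages)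
  have s: "summable (\<lambda>n. s n * z ^ n)"
    by (rule summable_bounded_powser[OF assms])
  have zS: "summable (\<lambda>n. z * (?S n * z ^ n))"
    by (intro summable_mult S)
  have "gf ?S z - s 0 = (\<Sum>n. ?S (Suc n) * z ^ Suc n)"
    using suminf_split_head[OF S] by (simp add: gf_def)
  also have "\<dots> = (\<Sum>n. z * (?S n * z ^ n) + s (Suc n) * z ^ Suc n)"
    by (simp add: algebra_simps)
  also have "\<dots> = z * gf ?S z + (\<Sum>n. s (Suc n) * z ^ Suc n)"
    using suminf_add[OF zS, of "\<lambda>n. s (Suc n) * z ^ Suc n"] s S
    by (simp add: gf_def suminf_mult summable_Suc_iff[of "\<lambda>n. s n * z ^ n", simplified])
  also have "(\<Sum>n. s (Suc n) * z ^ Suc n) = gf s z - s 0"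
    using suminf_split_head[OF s] by (simp add: gf_def)
  finally show "(1 - z) * gf ?S z = gf s z" by (simp add: algebra_simps)
qed

text \<open>Beyond some \<open>N\<close> the coefficients are below e/2, and the geometric series
  cancels the factor 1 - x. The first \<open>N\<close> terms stay bounded and are killed by that
  factor.\<close>

lemma gf_tendsto_0_scaled:
  assumes "s \<longlonglongrightarrow> 0"
  shows "((\<lambda>x. (1 - x) * gf s x) \<longlongrightarrow> 0) (at_left 1)"
proof (rule tendstoI)
  fix e :: real assume e: "e > 0"
  have B: "Bseq s" using assms convergent_imp_Bseq convergentI by blast
  then obtain K where K: "K > 0" "\<And>n. norm (s n) \<le> K"
    by (auto simp: Bseq_def)
  obtain N where N: "\<And>n. n \<ge> N \<Longrightarrow> norm (s n) < e / 2"
    using LIMSEQ_D[OF assms, of "e / 2"] e by auto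
  have bound: "\<bar>(1 - x) * gf s x\<bar> \<le> (1 - x) * (real N * K) + e / 2" if x: "0 < x" "x < 1" for x
  proof -
    have sm: "summable (\<lambda>n. norm (s n * x ^ n))"
      using summable_bounded_powser[of "\<lambda>n. \<bar>s n\<bar>" x] B x by (simp add: abs_mult Bseq_def)
    have 1: "(\<lambda>n. (if n < N then K else 0) + e / 2 * x ^ n) sums (real N * K + e / 2 * (1 / (1 - x)))"
      using x sums_If_finite[of "\<lambda>n. n < N" "\<lambda>_. K"]
      by (intro sums_add sums_mult geometric_sums) auto
    have "\<bar>gf s x\<bar> \<le> (\<Sum>n. norm (s n * x ^ n))"
      unfolding gf_def using summable_norm[OF sm] by simp
    also have "\<dots> \<le> (\<Sum>n. (if n < N then K else 0) + e / 2 * x ^ n)"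
    proof (rule suminf_le[OF _ sm sums_summable[OF 1]])
      fix n
      show "norm (s n * x ^ n) \<le> (if n < N then K else 0) + e / 2 * x ^ n"
      proof (cases "n < N")
        case True
        have "norm (s n * x ^ n) \<le> K * 1"
          unfolding norm_mult using x K power_le_one[of x n] by (intro mult_mono) auto
        with True x e show ?thesis by (simp add: add_increasing2)
      next
        case False
        then show ?thesis using N[of n] x by (simp add: abs_mult mult_right_mono)
      qed
    qed
    also have "\<dots> = real N * K + e / 2 * (1 / (1 - x))"
      by (rule sums_unique[symmetric, OF 1])
    finally have "(1 - x) * \<bar>gf s x\<bar> \<le> (1 - x) * (real N * K + e / 2 * (1 / (1 - x)))"
      using x by (intro mult_left_mono) auto
    also have "\<dots> = (1 - x) * (real N * K) + e / 2"
      using x by (simp add: field_simps)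
    finally show ?thesis using x by (simp add: abs_mult)
  qed
  have "((\<lambda>x::real. (1 - x) * (real N * K) + e / 2) \<longlongrightarrow> (1 - 1) * (real N * K) + e / 2) (at_left 1)"
    by (intro tendsto_intros)
  from order_tendstoD(2)[OF this, of e]
  have "\<forall>\<^sub>F x in at_left 1. (1 - x) * (real N * K) + e / 2 < e"
    using e by simp
  moreover have "\<forall>\<^sub>F x::real in at_left 1. x \<in> {0<..<1}"
    by (rule eventually_at_left_real) simp
  ultimately show "\<forall>\<^sub>F x in at_left 1. dist ((1 - x) * gf s x) 0 < e"
    by eventually_elim (use bound in \<open>force simp: dist_norm\<close>)
qed

text \<open>Since \<open>gf c\<close> is 1 - x times the series of partial sums, its deviation from
  the limit has the form treated by \<open>gf_tendsto_0_scaled\<close>.\<close>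

lemma Abel_limit:
  assumes "summable c"
  shows "((\<lambda>x. gf c x) \<longlongrightarrow> suminf c) (at_left 1)"
proof -
  let ?S = "\<lambda>n. \<Sum>i\<le>n. c i"
  have B: "Bseq c"
    using assms summable_LIMSEQ_zero convergent_imp_Bseq convergentI by blast
  have S: "?S \<longlonglongrightarrow> suminf c"
    by (rule summable_LIMSEQ'[OF assms])
  then have 0: "(\<lambda>n. ?S n - suminf c) \<longlonglongrightarrow> 0"
    by (simp add: LIM_zero_iff)
  have "((\<lambda>x. suminf c + (1 - x) * gf (\<lambda>n. ?S n - suminf c) x) \<longlongrightarrow> suminf c + 0) (at_left 1)"
    by (intro tendsto_intros gf_tendsto_0_scaled 0)
  moreover have "\<forall>\<^sub>F x::real in at_left 1. x \<in> {0<..<1}"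
    by (rule eventually_at_left_real) simp
  then have "\<forall>\<^sub>F x in at_left 1. suminf c + (1 - x) * gf (\<lambda>n. ?S n - suminf c) x = gf c x"
  proof eventually_elim
    case (elim x)
    then have x: "\<bar>x\<bar> < 1" by auto
    have geo: "(\<lambda>n. suminf c * x ^ n) sums (suminf c * (1 / (1 - x)))"
      using x by (intro sums_mult geometric_sums) auto
    have "gf (\<lambda>n. ?S n - suminf c) x = gf ?S x - suminf c * (1 / (1 - x))"
      unfolding gf_def left_diff_distrib
      using suminf_diff[OF gf_partial_sums(1)[OF B x] sums_summable[OF geo]] sums_unique[OF geo]
      by simp
    with elim gf_partial_sums(2)[OF B x] show ?case
      by (simp add: right_diff_distrib)
  qed
  ultimately show ?thesis
    by (simp add: filterlim_cong)
qed

text \<open>Without constant term a factor y comes out, and for |y| <= 1/2 the remaining geometric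
  series is at most 2. This linear rate later compensates the growth of another factor.\<close>

lemma gf_near_0:
  assumes "Bseq s" "s 0 = 0"
  obtains K where "\<And>y. \<bar>y\<bar> \<le> 1/2 \<Longrightarrow> \<bar>gf s y\<bar> \<le> K * \<bar>y\<bar>"
proof -
  obtain K where K: "K > 0" "\<And>n. norm (s n) \<le> K"
    using assms by (auto simp: Bseq_def)
  have "\<bar>gf s y\<bar> \<le> 2 * K * \<bar>y\<bar>" if y: "\<bar>y\<bar> \<le> 1/2" for y
  proof -
    have s: "summable (\<lambda>n. s n * y ^ n)"
      using assms y by (intro summable_bounded_powser) auto
    have s': "summable (\<lambda>n. norm (s n * y ^ n))"
      using summable_bounded_powser[of "\<lambda>n. \<bar>s n\<bar>" "\<bar>y\<bar>"] assms y
      by (simp add: abs_mult power_abs Bseq_def)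
    have geo: "(\<lambda>n. K * \<bar>y\<bar> * \<bar>y\<bar> ^ n) sums (K * \<bar>y\<bar> * (1 / (1 - \<bar>y\<bar>)))"
      using y by (intro sums_mult geometric_sums) auto
    have s'': "summable (\<lambda>n. norm (s (Suc n) * y ^ Suc n))"
      using s' by (subst summable_Suc_iff)
    have "gf s y = (\<Sum>n. s (Suc n) * y ^ Suc n)"
      using suminf_split_head[OF s] assms by (simp add: gf_def)
    also have "\<bar>\<dots>\<bar> \<le> (\<Sum>n. norm (s (Suc n) * y ^ Suc n))"
      using summable_norm[OF s''] by simp
    also have "\<dots> \<le> (\<Sum>n. K * \<bar>y\<bar> * \<bar>y\<bar> ^ n)"
      using K by (intro suminf_le s'' sums_summable[OF geo])
        (simp add: abs_mult power_abs mult_right_mono mult.assoc)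
    also have "\<dots> = K * \<bar>y\<bar> * (1 / (1 - \<bar>y\<bar>))"
      by (rule sums_unique[symmetric, OF geo])
    also have "\<dots> \<le> K * \<bar>y\<bar> * 2"
      using y K by (intro mult_left_mono) (auto simp: field_simps)
    finally show ?thesis by simp
  qed
  then show ?thesis using that by blast
qed

lemma gf_alternating: "gf (\<lambda>n. (-1) ^ n * s n) z = gf s (- z)"
  unfolding gf_def by (simp add: power_minus[of z] mult_ac)


section \<open>Iterated integrals and their duals\<close>

datatype letter = X0 | X1

fun form :: "letter \<Rightarrow> real \<Rightarrow> real" where
  "form X0 z = 1 / z"
| "form X1 z = 1 / (1 - z)"

text \<open>
  On Taylor coefficients, \<open>primitive c\<close> is multiplication by the form \<open>c\<close> followed by
  integration from \<open>0\<close>; \<open>dual_primitive c\<close> does the same with the pullback of \<open>c\<close> under the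
  involution \<open>z \<mapsto> - (1 + z) / (1 - z)\<close>, up to sign.
\<close>

fun primitive :: "letter \<Rightarrow> (nat \<Rightarrow> 'a::field) \<Rightarrow> nat \<Rightarrow> 'a" where
  "primitive X0 s = (\<lambda>n. s n / of_nat n)"
| "primitive X1 s = nest (\<lambda>n. 1 / of_nat n) s"

fun dual_primitive :: "letter \<Rightarrow> (nat \<Rightarrow> 'a::field) \<Rightarrow> nat \<Rightarrow> 'a" where
  "dual_primitive X0 s = (\<lambda>n. (\<Sum>i<n. ((-1) ^ (n - i) - 1) * s i) / of_nat n)"
| "dual_primitive X1 s = nest (\<lambda>n. 1 / of_nat n) s"

text \<open>The pullback of \<open>form\<close> by the involution, with the sign from reversing the
  path. For \<open>X0\<close> it is - 1/(1 + z) - 1/(1 - z) over a common denominator.\<close>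

fun dual_form :: "letter \<Rightarrow> real \<Rightarrow> real" where
  "dual_form X0 z = - 2 / (1 - z\<^sup>2)"
| "dual_form X1 z = 1 / (1 - z)"

lemma sqrt_decay_primitive:
  fixes s :: "nat \<Rightarrow> 'a::real_normed_field"
  assumes "sqrt_decay s"
  shows "sqrt_decay (primitive c s)"
proof (cases c)
  case X0
  have "norm (s n / of_nat n) \<le> norm (s n)" for n
    by (cases "n = 0") (auto simp: norm_divide divide_le_eq mult_le_cancel_left1)
  then show ?thesis
    using X0 by (auto intro!: sqrt_decay_le[OF assms])
next
  case X1
  then show ?thesis by (simp add: sqrt_decay_nest[OF assms] norm_divide)
qed

lemma sqrt_decay_dual_primitive:
  fixes s :: "nat \<Rightarrow> 'a::real_normed_field"
  assumes "sqrt_decay s"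
  shows "sqrt_decay (dual_primitive c s)"
proof (cases c)
  case X0
  have "norm (dual_primitive X0 s n) \<le> 2 / real n * (\<Sum>i<n. norm (s i))" for n
  proof -
    have "norm (\<Sum>i<n. ((-1) ^ (n - i) - 1) * s i) \<le> (\<Sum>i<n. 2 * norm (s i))"
    proof (rule sum_norm_le)
      fix i
      have "norm ((-1) ^ (n - i) - 1 :: 'a) \<le> 2"
        using norm_triangle_ineq4[of "(-1) ^ (n - i)" "1::'a"] by (simp add: norm_power)
      then show "norm (((-1) ^ (n - i) - 1) * s i) \<le> 2 * norm (s i)"
        unfolding norm_mult by (rule mult_right_mono) simp
    qed
    then show ?thesis
      by (simp add: norm_divide divide_right_mono flip: sum_distrib_left)
  qed
  then show ?thesis
    using sqrt_decay_averaging[OF assms, of 2] X0 by auto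
next
  case X1
  then show ?thesis by (simp add: sqrt_decay_nest[OF assms] norm_divide)
qed

lemma sqrt_decay_foldr_primitive:
  "sqrt_decay (foldr primitive w (unit_seq :: nat \<Rightarrow> 'a::real_normed_field))"
  by (induction w) (simp_all add: sqrt_decay_unit_seq sqrt_decay_primitive)

lemma sqrt_decay_fold_dual_primitive:
  "sqrt_decay (fold dual_primitive w (unit_seq :: nat \<Rightarrow> 'a::real_normed_field))"
  by (induction w rule: rev_induct) (simp_all add: sqrt_decay_unit_seq sqrt_decay_dual_primitive)

lemma primitive_0: "primitive c s 0 = 0"
  by (cases c) (simp_all add: nest_def)

lemma dual_primitive_0: "dual_primitive c s 0 = 0"
  by (cases c) (simp_all add: nest_def)

section \<open>Differential equations for the generating functions of primitives\<close>

lemma gf_primitive_X1_deriv: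
  assumes "Bseq s" "\<bar>z\<bar> < 1"
  shows "(gf (nest (\<lambda>n. 1 / real n) s) has_real_derivative 1 / (1 - z) * gf s z) (at z)"
proof -
  have "gf (\<lambda>n. \<Sum>i\<le>n. s i) z = 1 / (1 - z) * gf s z"
    using gf_partial_sums(2)[OF assms] assms(2) by (auto simp: field_simps)
  then show ?thesis
    using has_derivative_gf[OF Bseq_averages[OF assms(1)] assms(2)]
    by (simp add: diffs_averages)
qed

text \<open>The form dz / z has a pole at 0, so for \<open>X0\<close> the constant term must vanish
  for the quotient by z to be a power series again.\<close>

lemma gf_primitive_deriv:
  assumes s: "sqrt_decay s" and z: "\<bar>z\<bar> < 1" "z \<noteq> 0" and X0: "c = X0 \<Longrightarrow> s 0 = 0"
  shows "(gf (primitive c s) has_real_derivative form c z * gf s z) (at z)"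
proof (cases c)
  case X1
  then show ?thesis
    using gf_primitive_X1_deriv[OF sqrt_decay_Bseq[OF s] z(1)] by simp
next
  case X0
  have sm: "summable (\<lambda>n. s n * z ^ n)"
    by (rule summable_bounded_powser[OF sqrt_decay_Bseq[OF s] z(1)])
  have "diffs (primitive X0 s) = (\<lambda>n. s (Suc n))"
    by (auto simp: diffs_def simp del: of_nat_Suc)
  then have "gf (diffs (primitive X0 s)) z = gf s z / z"
    using powser_split_head(1)[OF sm] \<open>c = X0\<close> assms(4) z by (simp add: gf_def)
  then show ?thesis
    using has_derivative_gf[OF sqrt_decay_Bseq[OF sqrt_decay_primitive[OF s]] z(1), of X0] X0
    by simp
qed

text \<open>Both dual forms are regular at 0, so no condition on the constant term arises. For
  \<open>X0\<close>, the alternating weights produce the pole at -1 and the constant weights the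
  pole at 1.\<close>

lemma gf_dual_primitive_deriv:
  assumes s: "sqrt_decay s" and z: "\<bar>z\<bar> < 1"
  shows "(gf (dual_primitive c s) has_real_derivative dual_form c z * gf s z) (at z)"
proof (cases c)
  case X1
  then show ?thesis
    using gf_primitive_X1_deriv[OF sqrt_decay_Bseq[OF s] z] by simp
next
  case X0
  let ?s' = "\<lambda>n. (-1) ^ n * s n"
  have B: "Bseq s" "Bseq ?s'"
    using sqrt_decay_Bseq[OF s] by (simp_all add: Bseq_def abs_mult)
  have z': "\<bar>- z\<bar> < 1" and nz: "1 + z \<noteq> 0" "1 - z \<noteq> 0" using z by auto
  note 1 = gf_partial_sums[OF B(1) z] and 2 = gf_partial_sums[OF B(2) z']
  have diffs: "diffs (dual_primitive X0 s) n = - ((-1) ^ n * (\<Sum>i\<le>n. ?s' i)) - (\<Sum>i\<le>n. s i)" for n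
  proof -
    have "diffs (dual_primitive X0 s) n = (\<Sum>i\<le>n. ((-1) ^ (Suc n - i) - 1) * s i)"
      by (simp add: diffs_def lessThan_Suc_atMost del: of_nat_Suc)
    also have "\<dots> = (\<Sum>i\<le>n. - ((-1) ^ n * ?s' i) - s i)"
    proof (rule sum.cong[OF refl])
      fix i assume "i \<in> {..n}"
      \<comment> \<open>As \<open>i\<close> <= \<open>n\<close>, the natural subtraction is exact
        and the sign factorises.\<close>
      then have "(-1) ^ (Suc n - i) = - ((-1) ^ n * (-1) ^ i :: real)"
        by (auto simp: minus_one_power_iff)
      then show "((-1) ^ (Suc n - i) - 1) * s i = - ((-1) ^ n * ?s' i) - s i"
        by (simp add: algebra_simps)
    qed
    finally show ?thesis
      by (simp add: sum_subtractf sum_negf sum_distrib_left)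
  qed
  have "gf (diffs (dual_primitive X0 s)) z =
      (\<Sum>n. - ((\<Sum>i\<le>n. ?s' i) * (- z) ^ n) - (\<Sum>i\<le>n. s i) * z ^ n)"
    unfolding gf_def diffs by (simp add: power_minus[of z] left_diff_distrib right_diff_distrib mult_ac)
  also have "\<dots> = - gf (\<lambda>n. \<Sum>i\<le>n. ?s' i) (- z) - gf (\<lambda>n. \<Sum>i\<le>n. s i) z"
    using suminf_diff[OF summable_minus[OF 2(1)] 1(1)] suminf_minus[OF 2(1)] by (simp add: gf_def)
  also have "\<dots> = - (gf s z / (1 + z)) - gf s z / (1 - z)"
  proof -
    have "gf (\<lambda>n. \<Sum>i\<le>n. ?s' i) (- z) = gf s z / (1 + z)"
      using 2(2) nz unfolding gf_alternating by (simp add: nonzero_eq_divide_eq mult.commute)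
    moreover have "gf (\<lambda>n. \<Sum>i\<le>n. s i) z = gf s z / (1 - z)"
      using 1(2) nz by (simp add: nonzero_eq_divide_eq mult.commute)
    ultimately show ?thesis by simp
  qed
  also have "\<dots> = dual_form X0 z * gf s z"
  proof -
    have "dual_form X0 z = - 2 / ((1 + z) * (1 - z))"
      by (simp add: power2_eq_square algebra_simps)
    also have "\<dots> = - (1 / (1 + z)) - 1 / (1 - z)"
      using nz by (simp add: divide_simps)
    finally have eq: "dual_form X0 z = - (1 / (1 + z)) - 1 / (1 - z)" .
    show ?thesis unfolding eq by (simp add: left_diff_distrib)
  qed
  finally show ?thesis
    using has_derivative_gf[OF sqrt_decay_Bseq[OF sqrt_decay_dual_primitive[OF s]] z, of X0] X0
    by simp
qed

text \<open>The path from 0 to -1 is parametrised by z = -x; in this coordinate z \<mapsto> -(1 +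
  z)/(1 - z) becomes x \<mapsto> (1 - x)/(1 + x).\<close>

definition involution :: "real \<Rightarrow> real" where
  "involution x = (1 - x) / (1 + x)"

lemma involution_bounds:
  assumes "0 < x" "x < 1"
  shows "0 < involution x" "involution x < 1" "involution x \<le> 1 - x"
  using assms by (simp_all add: involution_def field_simps)

lemma involution_involution: "0 < x \<Longrightarrow> involution (involution x) = x"
  by (simp add: involution_def field_simps)

lemma involution_deriv:
  assumes "0 < x"
  shows "(involution has_real_derivative - 2 / (1 + x)\<^sup>2) (at x)"
  unfolding involution_def[abs_def] using assms
  by (auto intro!: derivative_eq_intros simp: field_simps power2_eq_square)

text \<open>The substitution rule for the two forms: \<open>2 / (1 + x)\<^sup>2\<close> is minus the
  derivative of \<open>involution\<close>. It makes the two halves of the derivative in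
  \<open>duality\<close> cancel.\<close>

lemma dual_form_involution:
  assumes "0 < x" "x < 1"
  shows "dual_form c (- involution x) * (2 / (1 + x)\<^sup>2) = form c (- x)"
proof (cases c)
  case X0
  have "1 - (involution x)\<^sup>2 = 4 * x / (1 + x)\<^sup>2"
    using assms by (simp add: involution_def divide_simps) (simp add: power2_eq_square algebra_simps)
  then have eq: "dual_form X0 (- involution x) = - 2 / (4 * x / (1 + x)\<^sup>2)"
    by (simp only: dual_form.simps power2_minus)
  show ?thesis unfolding X0 eq using assms by (simp add: field_simps)
next
  case X1
  have "1 + involution x = 2 / (1 + x)"
    using assms by (simp add: involution_def field_simps)
  then have eq: "dual_form X1 (- involution x) = 1 / (2 / (1 + x))"
    by (simp only: dual_form.simps diff_minus_eq_add)
  have "1 / (2 / y) * (2 / y\<^sup>2) = 1 / y" if "y > 0" for y :: real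
    using that by (simp add: field_simps power2_eq_square)
  from this[of "1 + x"] assms have "1 / (2 / (1 + x)) * (2 / (1 + x)\<^sup>2) = 1 / (1 + x)"
    by (simp only: add_pos_pos zero_less_one)
  then show ?thesis by (simp only: X1 eq form.simps diff_minus_eq_add)
qed

text \<open>The first factor may blow up as x tends to 1, but only as o(1/(1 - x)); the second is
  O(1 - x), because it vanishes linearly at 0 and \<open>involution x\<close> <= 1 - x.\<close>

lemma gf_cross_term_tendsto_0:
  assumes s: "sqrt_decay s" and t: "Bseq t" "t 0 = 0"
  shows "((\<lambda>x. gf s (- x) * gf t (- involution x)) \<longlongrightarrow> 0) (at_left 1)"
proof -
  obtain K where K: "\<And>y. \<bar>y\<bar> \<le> 1/2 \<Longrightarrow> \<bar>gf t y\<bar> \<le> K * \<bar>y\<bar>"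
    using gf_near_0[OF t] by blast
  have "0 \<le> \<bar>gf t (1/2)\<bar>" by simp
  also have "\<dots> \<le> K * (1/2)" using K[of "1/2"] by simp
  finally have K0: "K \<ge> 0" by simp
  have "(\<lambda>n. (-1) ^ n * s n) \<longlonglongrightarrow> 0"
    using sqrt_decay_tendsto_0[OF s] by (subst tendsto_norm_zero_iff[symmetric])
      (simp add: abs_mult tendsto_rabs_zero)
  from gf_tendsto_0_scaled[OF this]
  have "((\<lambda>x. (1 - x) * gf s (- x)) \<longlongrightarrow> 0) (at_left 1)"
    by (simp add: gf_alternating)
  then have lim: "((\<lambda>x. K * \<bar>(1 - x) * gf s (- x)\<bar>) \<longlongrightarrow> 0) (at_left 1)"
    by (intro tendsto_mult_right_zero tendsto_rabs_zero)
  have "\<forall>\<^sub>F x::real in at_left 1. x \<in> {1/2<..<1}"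
    by (rule eventually_at_left_real) simp
  then have "\<forall>\<^sub>F x in at_left 1. norm (gf s (- x) * gf t (- involution x))
      \<le> K * \<bar>(1 - x) * gf s (- x)\<bar>"
  proof eventually_elim
    case (elim x)
    then have b: "0 < involution x" "involution x < 1" "involution x \<le> 1 - x"
      using involution_bounds[of x] by auto
    have "\<bar>gf t (- involution x)\<bar> \<le> K * \<bar>- involution x\<bar>"
      using elim b by (intro K) auto
    also have "\<dots> \<le> K * (1 - x)"
      using b K0 by (intro mult_left_mono) auto
    finally have "\<bar>gf s (- x)\<bar> * \<bar>gf t (- involution x)\<bar> \<le> \<bar>gf s (- x)\<bar> * (K * (1 - x))"
      by (intro mult_left_mono) auto
    then show ?case using elim by (simp add: abs_mult mult_ac)
  qed
  then show ?thesis using lim by (rule Lim_null_comparison)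
qed

text \<open>
  Path composition: splitting the path from \<open>0\<close> to \<open>-1\<close> at \<open>-x\<close> expresses the iterated integral
  of \<open>w\<close> as the sum over all factorisations of \<open>w\<close>. That sum does not depend on \<open>x\<close>, because its
  derivative telescopes, and its two end points are the two sides.
\<close>

theorem duality:
  fixes w :: "letter list"
  assumes w: "w \<noteq> []" "hd w = X1" "last w = X1"
  shows "summable (\<lambda>n. (-1) ^ n * foldr primitive w (unit_seq :: nat \<Rightarrow> real) n)"
    and "summable (\<lambda>n. (-1) ^ n * fold dual_primitive w (unit_seq :: nat \<Rightarrow> real) n)"
    and "(\<Sum>n. (-1) ^ n * foldr primitive w (unit_seq :: nat \<Rightarrow> real) n) =
         (\<Sum>n. (-1) ^ n * fold dual_primitive w unit_seq n)"
proof -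
  \<comment> \<open>\<open>e j\<close> integrates the suffix of \<open>w\<close> from position
    \<open>j\<close>; \<open>d j\<close> integrates the prefix before \<open>j\<close> in dual
    forms, reversed because \<open>fold\<close> applies the first letter innermost.\<close>
  define e where "e j = foldr primitive (drop j w) (unit_seq :: nat \<Rightarrow> real)" for j
  define d where "d j = fold dual_primitive (take j w) (unit_seq :: nat \<Rightarrow> real)" for j
  define L where "L = length w"
  have decay: "sqrt_decay (e j)" "sqrt_decay (d j)" for j
    unfolding e_def d_def
    by (rule sqrt_decay_foldr_primitive sqrt_decay_fold_dual_primitive)+
  note B = decay[THEN sqrt_decay_Bseq]
  have e_step: "e j = primitive (w ! j) (e (Suc j))" if "j < L" for j
    using that by (simp add: e_def L_def flip: Cons_nth_drop_Suc)
  have d_step: "d (Suc j) = dual_primitive (w ! j) (d j)" if "j < L" for j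
    using that by (simp add: d_def L_def take_Suc_conv_app_nth)
  have e_0: "e j 0 = 0" if "j < L" for j
    using e_step[OF that] by (simp add: primitive_0)
  have d_0: "d j 0 = 0" if "0 < j" "j \<le> L" for j
    using that d_step[of "j - 1"] by (simp add: dual_primitive_0)
  have gf_unit: "gf unit_seq z = 1" for z
  proof -
    have "(\<lambda>n. unit_seq n * z ^ n) = (\<lambda>n. if n = 0 then 1 else 0)"
      by (auto simp: unit_seq_def)
    then show ?thesis unfolding gf_def using sums_single[of 0 "\<lambda>_. 1::real"] by (simp add: sums_iff)
  qed
  have ends: "e L = unit_seq" "d 0 = unit_seq"
    by (simp_all add: e_def d_def L_def)
  have "L > 0" using w by (simp add: L_def)

  \<comment> \<open>The first letter being \<open>X1\<close> makes the outermost operation an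
    average, giving convergence at -1; the last letter does the same for \<open>d L\<close>.\<close>
  have "e 0 = nest (\<lambda>n. 1 / of_nat n) (e 1)"
    using e_step[of 0] \<open>L > 0\<close> w by (simp add: hd_conv_nth)
  then have sum_e: "summable (\<lambda>n. (-1) ^ n * e 0 n)"
    using summable_alternating[OF decay(1)[of 1]] by simp
  then show "summable (\<lambda>n. (-1) ^ n * foldr primitive w (unit_seq :: nat \<Rightarrow> real) n)"
    by (simp add: e_def)
  have "d L = nest (\<lambda>n. 1 / of_nat n) (d (L - 1))"
    using d_step[of "L - 1"] \<open>L > 0\<close> w by (simp add: last_conv_nth L_def)
  then have sum_d: "summable (\<lambda>n. (-1) ^ n * d L n)"
    using summable_alternating[OF decay(2)[of "L - 1"]] by simp
  then show "summable (\<lambda>n. (-1) ^ n * fold dual_primitive w (unit_seq :: nat \<Rightarrow> real) n)"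
    by (simp add: d_def L_def)

  define G where "G x = (\<Sum>j\<le>L. gf (e j) (- x) * gf (d j) (- involution x))" for x
  have deriv: "(G has_real_derivative 0) (at x)" if x: "0 < x" "x < 1" for x
  proof -
    define f where "f j = form (w ! j) (- x)" for j
    \<comment> \<open>The derivatives of the two factors. The zero branches belong to the constant
      factors \<open>e L\<close> and \<open>d 0\<close>.\<close>
    define a where "a j = (if j < L then - f j * gf (e (Suc j)) (- x) else 0)" for j
    define b where "b j = (if j = 0 then 0 else f (j - 1) * gf (d (j - 1)) (- involution x))" for j
    have "((\<lambda>x. gf (e j) (- x)) has_real_derivative a j) (at x)" if "j \<le> L" for j
    proof (cases "j = L")
      case True
      then show ?thesis by (simp add: a_def ends gf_unit)
    next
      case False
      with that have j: "j < L" by simp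
      \<comment> \<open>Since \<open>w\<close> ends in \<open>X1\<close>, a letter \<open>X0\<close>
        is followed by a nonempty suffix, whose series has no constant term.\<close>
      have "w ! j = X0 \<Longrightarrow> Suc j \<noteq> L"
        using w last_conv_nth[of w] by (cases w) (auto simp: L_def)
      then have "(gf (e j) has_real_derivative f j * gf (e (Suc j)) (- x)) (at (- x))"
        unfolding e_step[OF j] f_def using x j
        by (intro gf_primitive_deriv decay e_0) auto
      from DERIV_chain2[where f = "gf (e j)" and g = uminus and x = x,
          OF this DERIV_minus[OF DERIV_ident]] j show ?thesis
        by (simp add: a_def)
    qed
    moreover have "((\<lambda>x. gf (d j) (- involution x)) has_real_derivative b j) (at x)" if "j \<le> L" for j
    proof (cases j)
      case 0
      then show ?thesis by (simp add: b_def ends gf_unit)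
    next
      case (Suc i)
      with that have i: "i < L" by simp
      have D: "(gf (d j) has_real_derivative
          dual_form (w ! i) (- involution x) * gf (d i) (- involution x)) (at (- involution x))"
        unfolding Suc d_step[OF i] using involution_bounds[OF x]
        by (intro gf_dual_primitive_deriv decay) auto
      have eq: "dual_form (w ! i) (- involution x) * gf (d i) (- involution x) *
          - (- 2 / (1 + x)\<^sup>2) = b j"
        unfolding b_def f_def Suc diff_Suc_1 dual_form_involution[OF x, symmetric] by simp
      show ?thesis
        using DERIV_chain2[OF D DERIV_minus[OF involution_deriv[OF x(1)]]] unfolding eq .
    qed
    ultimately have "(G has_real_derivative
        (\<Sum>j\<le>L. a j * gf (d j) (- involution x) + b j * gf (e j) (- x))) (at x)"
      unfolding G_def by (intro DERIV_sum DERIV_mult) auto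
    moreover have "(\<Sum>j\<le>L. a j * gf (d j) (- involution x)) =
        - (\<Sum>j<L. f j * gf (e (Suc j)) (- x) * gf (d j) (- involution x))"
      unfolding lessThan_Suc_atMost[symmetric] sum.lessThan_Suc
      by (simp add: a_def sum_negf)
    \<comment> \<open>After the index shift, the \<open>b\<close>-term at \<open>j + 1\<close>
      cancels the \<open>a\<close>-term at \<open>j\<close>.\<close>
    moreover have "(\<Sum>j\<le>L. b j * gf (e j) (- x)) =
        (\<Sum>j<L. f j * gf (e (Suc j)) (- x) * gf (d j) (- involution x))"
      unfolding lessThan_Suc_atMost[symmetric] sum.lessThan_Suc_shift
      by (simp add: b_def mult_ac)
    ultimately show ?thesis by (simp add: sum.distrib)
  qed
  have const: "G x = G (1/2)" if "0 < x" "x < 1" for x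
    using that deriv by (intro DERIV_isconst3[of 0 1 x "1/2" G]) auto
  have in_unit: "\<forall>\<^sub>F x::real in at_left 1. x \<in> {0<..<1}"
    by (rule eventually_at_left_real) simp

  \<comment> \<open>As x tends to 1 the dual factors are evaluated near 0, so only
    \<open>j = 0\<close> survives, where \<open>d 0\<close> is 1.\<close>
  have "((\<lambda>x. gf (e j) (- x) * gf (d j) (- involution x)) \<longlongrightarrow>
      (if j = 0 then \<Sum>n. (-1) ^ n * e 0 n else 0)) (at_left 1)" if "j \<le> L" for j
    using that Abel_limit[OF sum_e] gf_cross_term_tendsto_0[OF decay(1)[of j] B(2)[of j] d_0[of j]]
    by (auto simp: ends gf_unit gf_alternating)
  then have "(G \<longlongrightarrow> (\<Sum>j\<le>L. if j = 0 then \<Sum>n. (-1) ^ n * e 0 n else 0)) (at_left 1)"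
    unfolding G_def by (intro tendsto_sum) auto
  then have "(G \<longlongrightarrow> (\<Sum>n. (-1) ^ n * e 0 n)) (at_left 1)"
    by simp
  moreover have "(G \<longlongrightarrow> G (1/2)) (at_left 1)"
  proof (rule tendsto_eventually, use in_unit in eventually_elim)
    case (elim x)
    then show ?case by (intro const) auto
  qed
  ultimately have left: "G (1/2) = (\<Sum>n. (-1) ^ n * e 0 n)"
    by (intro tendsto_unique[of "at_left (1::real)" G]) auto

  \<comment> \<open>The end point x = 0 is reached by replacing x with \<open>involution x\<close>;
    the factors exchange roles and only \<open>j = L\<close> survives.\<close>
  have "((\<lambda>x. gf (d j) (- x) * gf (e j) (- involution x)) \<longlongrightarrow>
      (if j = L then \<Sum>n. (-1) ^ n * d L n else 0)) (at_left 1)" if "j \<le> L" for j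
    using that Abel_limit[OF sum_d] gf_cross_term_tendsto_0[OF decay(2)[of j] B(1)[of j] e_0[of j]]
    by (auto simp: ends gf_unit gf_alternating)
  then have "((\<lambda>x. \<Sum>j\<le>L. gf (d j) (- x) * gf (e j) (- involution x)) \<longlongrightarrow>
      (\<Sum>j\<le>L. if j = L then \<Sum>n. (-1) ^ n * d L n else 0)) (at_left 1)"
    by (intro tendsto_sum) auto
  then have "((\<lambda>x. \<Sum>j\<le>L. gf (d j) (- x) * gf (e j) (- involution x)) \<longlongrightarrow>
      (\<Sum>n. (-1) ^ n * d L n)) (at_left 1)"
    by simp
  moreover have "((\<lambda>x. \<Sum>j\<le>L. gf (d j) (- x) * gf (e j) (- involution x)) \<longlongrightarrow> G (1/2)) (at_left 1)"
  proof (rule tendsto_eventually, use in_unit in eventually_elim)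
    case (elim x)
    then have "G (involution x) = G (1/2)"
      using involution_bounds[of x] by (intro const) auto
    with elim show ?case
      by (simp add: G_def involution_involution mult.commute)
  qed
  ultimately have right: "G (1/2) = (\<Sum>n. (-1) ^ n * d L n)"
    by (intro tendsto_unique[of "at_left (1::real)"
          "\<lambda>x. \<Sum>j\<le>L. gf (d j) (- x) * gf (e j) (- involution x)"]) auto

  from left right show "(\<Sum>n. (-1) ^ n * foldr primitive w (unit_seq :: nat \<Rightarrow> real) n) =
      (\<Sum>n. (-1) ^ n * fold dual_primitive w unit_seq n)"
    by (simp add: e_def d_def L_def)
qed


section \<open>Multiple polylogarithms of weight equal to depth\<close>

definition polylog_step :: "'a::field \<Rightarrow> (nat \<Rightarrow> 'a) \<Rightarrow> nat \<Rightarrow> 'a" where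
  "polylog_step z = nest (\<lambda>n. z ^ n / of_nat n)"

lemma polylog_step_apply: "polylog_step z s n = z ^ n / of_nat n * (\<Sum>i<n. s i)"
  by (simp add: polylog_step_def nest_def)

lemma multi_polylog_partial_ones:
  assumes "length zs = r"
  shows "multi_polylog_partial (replicate r 1) zs N = (\<Sum>n\<le>N. foldr polylog_step zs unit_seq n)"
proof -
  have "multi_polylog_partial (replicate r 1) zs N =
      (\<Sum>ns\<in>strict_index_lists (length (map (\<lambda>z n. z ^ n / of_nat n) zs)) N.
        \<Prod>j<length (map (\<lambda>z n. z ^ n / of_nat n) zs). (map (\<lambda>z n. z ^ n / of_nat n) zs ! j) (ns ! j))"
    using assms by (simp add: multi_polylog_partial_def)
  also have "\<dots> = (\<Sum>n\<le>N. foldr polylog_step zs unit_seq n)"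
    unfolding sum_strict_index_lists by (simp add: foldr_map comp_def polylog_step_def[abs_def])
  finally show ?thesis .
qed

lemma sqrt_decay_foldr_polylog_step:
  fixes zs :: "'a::real_normed_field list"
  assumes "\<And>z. z \<in> set zs \<Longrightarrow> norm z = 1"
  shows "sqrt_decay (foldr polylog_step zs unit_seq)"
  using assms
proof (induction zs)
  case (Cons z zs)
  then show ?case
    by (simp add: polylog_step_def) (rule sqrt_decay_nest, simp_all add: norm_divide norm_power)
qed (simp add: sqrt_decay_unit_seq)

lemma polylog_step_minus_1: "polylog_step (-1) s n = (-1) ^ n * dual_primitive X1 s n"
  by (simp add: polylog_step_def nest_def)

text \<open>The leading argument -1 supplies an outermost alternating average, which suffices for
  convergence when the other arguments lie on the unit circle.\<close>

lemma multi_polylog_ones_sums: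
  assumes "length zs + 1 = r" "\<And>z. z \<in> set zs \<Longrightarrow> norm z = 1"
  shows "foldr polylog_step (-1 # zs) unit_seq sums multi_polylog (replicate r 1) (-1 # zs)"
proof -
  have "summable (foldr polylog_step (-1 # zs) unit_seq)"
    using summable_alternating[OF sqrt_decay_foldr_polylog_step[OF assms(2)]]
    by (simp add: polylog_step_minus_1[abs_def])
  then obtain l where l: "foldr polylog_step (-1 # zs) unit_seq sums l"
    by (auto simp: summable_def)
  moreover have "multi_polylog_partial (replicate r 1) (-1 # zs) =
      (\<lambda>N. \<Sum>n\<le>N. foldr polylog_step (-1 # zs) unit_seq n)"
    using assms(1) by (intro ext multi_polylog_partial_ones) simp
  ultimately have "multi_polylog_partial (replicate r 1) (-1 # zs) \<longlonglongrightarrow> l"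
    by (simp add: sums_def_le)
  then show ?thesis
    using l by (simp add: multi_polylog_def limI)
qed

text \<open>This lets a sum over signs be moved past the outer arguments to the block that contains
  the sign.\<close>

lemma foldr_polylog_step_linear:
  "foldr polylog_step zs (\<lambda>n. \<Sum>y\<in>Y. c y * s y n) =
   (\<lambda>n. \<Sum>y\<in>Y. c y * foldr polylog_step zs (s y) n)"
proof (induction zs)
  case (Cons z zs)
  have swap: "(\<Sum>i<n. \<Sum>y\<in>Y. c y * foldr polylog_step zs (s y) i) =
        (\<Sum>y\<in>Y. c y * (\<Sum>i<n. foldr polylog_step zs (s y) i))" for n
    by (subst sum.swap) (simp add: sum_distrib_left)
  show ?case
  proof
    fix n
    have "foldr polylog_step (z # zs) (\<lambda>n. \<Sum>y\<in>Y. c y * s y n) n =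
        z ^ n / of_nat n * (\<Sum>y\<in>Y. c y * (\<Sum>i<n. foldr polylog_step zs (s y) i))"
      by (simp only: foldr.simps comp_apply Cons polylog_step_apply[of z] swap)
    also have "\<dots> = (\<Sum>y\<in>Y. c y * foldr polylog_step (z # zs) (s y) n)"
      unfolding sum_distrib_left[of "z ^ n / of_nat n"]
      by (intro sum.cong) (simp_all add: polylog_step_apply[of z])
    finally show "foldr polylog_step (z # zs) (\<lambda>n. \<Sum>y\<in>Y. c y * s y n) n =
        (\<Sum>y\<in>Y. c y * foldr polylog_step (z # zs) (s y) n)" .
  qed
qed simp

lemma polylog_step_1: "polylog_step 1 = dual_primitive X1"
  by (simp add: polylog_step_def fun_eq_iff)

text \<open>
  Splitting \<open>dual_form X0\<close> into partial fractions produces the sum over a sign; the repeated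
  argument arises because the poles on both sides of the new one are equal.
\<close>

lemma dual_primitive_X0_expand:
  fixes s :: "nat \<Rightarrow> complex"
  assumes "p \<ge> 1"
  shows "(\<Sum>y\<in>{-1, 1}. - y * foldr polylog_step ([y, y] @ replicate (p - 1) 1) s n) =
         foldr dual_primitive (X0 # replicate p X1) s n"
proof -
  define t where "t = foldr dual_primitive (replicate (p - 1) X1) s"
  define u where "u = dual_primitive X1 t"
  \<comment> \<open>One of the \<open>p\<close> letters \<open>X1\<close> is carried by the inner
    argument \<open>y\<close>; the others give the \<open>p - 1\<close> arguments 1.\<close>
  have u: "foldr dual_primitive (replicate p X1) s = u"
    using assms by (cases p) (simp_all add: u_def t_def)
  have inner: "polylog_step y t i = y ^ i * u i" for y i
    by (simp add: u_def polylog_step_def nest_def)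
  have sign: "(-1) ^ (n - i) = (-1) ^ n * (-1 :: complex) ^ i" if "i < n" for i
    using that by (auto simp: minus_one_power_iff)
  have "(\<Sum>y\<in>{-1, 1}. - y * foldr polylog_step ([y, y] @ replicate (p - 1) 1) s n) =
      polylog_step (-1) (polylog_step (-1) t) n - polylog_step 1 (polylog_step 1 t) n"
    by (simp add: t_def polylog_step_1 del: dual_primitive.simps)
  also have "\<dots> = ((-1) ^ n * (\<Sum>i<n. (-1) ^ i * u i) - (\<Sum>i<n. u i)) / of_nat n"
    unfolding polylog_step_apply[of _ "polylog_step _ _"] inner
    by (simp add: diff_divide_distrib)
  also have "(-1) ^ n * (\<Sum>i<n. (-1) ^ i * u i) - (\<Sum>i<n. u i) =
      (\<Sum>i<n. ((-1) ^ (n - i) - 1) * u i)"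
    by (simp add: sum_distrib_left sum_subtractf[symmetric] sign left_diff_distrib mult.assoc)
  finally show ?thesis by (simp only: foldr.simps comp_apply u dual_primitive.simps(1))
qed

text \<open>Induction removes the last, innermost block: its sign is summed first and turns
  \<open>s\<close> into a new inner sequence, hence the generalisation over
  \<open>s\<close>.\<close>

lemma sum_signs_polylog:
  fixes s :: "nat \<Rightarrow> complex"
  assumes "\<And>i. i \<in> {1..k} \<Longrightarrow> p i \<ge> 1"
  shows "(\<Sum>\<sigma>\<in>{1..k} \<rightarrow>\<^sub>E {-1, 1}. (\<Prod>i=1..k. - \<sigma> i) *
            foldr polylog_step (concat (map (\<lambda>i. [\<sigma> i, \<sigma> i] @ replicate (p i - 1) 1) [1..<k+1])) s n) =
         foldr dual_primitive (concat (map (\<lambda>i. X0 # replicate (p i) X1) [1..<k+1])) s n"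
  using assms
proof (induction k arbitrary: s n)
  case 0
  then show ?case by simp
next
  case (Suc k)
  define Z where "Z \<sigma> = concat (map (\<lambda>i. [\<sigma> i, \<sigma> i] @ replicate (p i - 1) 1) [1..<k+1])"
    for \<sigma> :: "nat \<Rightarrow> complex"
  define z where "z y = [y, y] @ replicate (p (Suc k) - 1) 1" for y :: complex
  have Z_upd: "Z (\<sigma>(Suc k := y)) = Z \<sigma>" for \<sigma> y
    unfolding Z_def by (intro arg_cong[of _ _ concat] map_cong) auto
  have prod_upd: "(\<Prod>i=1..Suc k. - (\<sigma>(Suc k := y)) i) = (\<Prod>i=1..k. - \<sigma> i) * (- y)"
    for \<sigma> :: "nat \<Rightarrow> complex" and y
    by (simp add: atLeastAtMostSuc_conv)
  have upt: "[1..<Suc k + 1] = [1..<k+1] @ [Suc k]"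
    by simp
  have PiE: "{1..Suc k} \<rightarrow>\<^sub>E {-1, 1 :: complex} =
      (\<lambda>(y, \<sigma>). \<sigma>(Suc k := y)) ` ({-1, 1} \<times> ({1..k} \<rightarrow>\<^sub>E {-1, 1}))"
    by (simp add: atLeastAtMostSuc_conv PiE_insert_eq)
  have "(\<Sum>\<sigma>\<in>{1..Suc k} \<rightarrow>\<^sub>E {-1, 1}. (\<Prod>i=1..Suc k. - \<sigma> i) *
      foldr polylog_step (concat (map (\<lambda>i. [\<sigma> i, \<sigma> i] @ replicate (p i - 1) 1) [1..<Suc k+1])) s n)
    = (\<Sum>\<sigma>\<in>{1..Suc k} \<rightarrow>\<^sub>E {-1, 1}. (\<Prod>i=1..Suc k. - \<sigma> i) *
        foldr polylog_step (Z \<sigma> @ z (\<sigma> (Suc k))) s n)"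
    unfolding upt by (simp add: Z_def z_def del: upt_Suc)
  also have "\<dots> =
      (\<Sum>(y, \<sigma>)\<in>{-1, 1} \<times> ({1..k} \<rightarrow>\<^sub>E {-1, 1}).
        (\<Prod>i=1..k. - \<sigma> i) * (- y) * foldr polylog_step (Z \<sigma> @ z y) s n)"
    unfolding PiE
  proof (subst sum.reindex[OF inj_combinator])
    show "Suc k \<notin> {1..k}" by simp
  qed (intro sum.cong refl, clarify, simp only: comp_apply case_prod_conv prod_upd Z_upd fun_upd_same)
  also have "\<dots> = (\<Sum>\<sigma>\<in>{1..k} \<rightarrow>\<^sub>E {-1, 1}. \<Sum>y\<in>{-1, 1}.
        (\<Prod>i=1..k. - \<sigma> i) * (- y) * foldr polylog_step (Z \<sigma> @ z y) s n)"
    by (subst sum.swap) (simp add: sum.cartesian_product)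
  also have "\<dots> = (\<Sum>\<sigma>\<in>{1..k} \<rightarrow>\<^sub>E {-1, 1}. (\<Prod>i=1..k. - \<sigma> i) *
        foldr polylog_step (Z \<sigma>) (\<lambda>n. \<Sum>y\<in>{-1, 1}. - y * foldr polylog_step (z y) s n) n)"
    unfolding foldr_polylog_step_linear foldr_append comp_def sum_distrib_left
    by (simp only: mult.assoc)
  also have "(\<lambda>n. \<Sum>y\<in>{-1, 1}. - y * foldr polylog_step (z y) s n) =
      foldr dual_primitive (X0 # replicate (p (Suc k)) X1) s"
    unfolding z_def using Suc.prems by (intro ext dual_primitive_X0_expand) auto
  also have "(\<Sum>\<sigma>\<in>{1..k} \<rightarrow>\<^sub>E {-1, 1}. (\<Prod>i=1..k. - \<sigma> i) * foldr polylog_step (Z \<sigma>) \<dots> n) =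
      foldr dual_primitive (concat (map (\<lambda>i. X0 # replicate (p i) X1) [1..<k+1])) \<dots> n"
    unfolding Z_def using Suc.prems by (intro Suc.IH) auto
  finally show ?case
    by (simp only: upt map_append concat_append foldr_append list.map concat.simps append_Nil2 comp_apply)
qed

lemma of_real_foldr_dual_primitive:
  "complex_of_real (foldr dual_primitive w unit_seq n) = foldr dual_primitive w unit_seq n"
proof (induction w arbitrary: n)
  case (Cons c w)
  then show ?case by (cases c) (simp_all add: nest_def)
qed (simp add: unit_seq_def)


section \<open>Alternating multiple zeta values\<close>

definition mzv_step :: "int \<Rightarrow> (nat \<Rightarrow> real) \<Rightarrow> nat \<Rightarrow> real" where
  "mzv_step a = nest (\<lambda>n. of_int (sgn a) ^ n / real n ^ nat \<bar>a\<bar>)"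

lemma alt_mzv_partial_eq: "alt_mzv_partial ss N = (\<Sum>n\<le>N. foldr mzv_step ss unit_seq n)"
proof -
  let ?gs = "map (\<lambda>a n. of_int (sgn a) ^ n / real n ^ nat \<bar>a\<bar>) ss"
  have "alt_mzv_partial ss N =
      (\<Sum>ns\<in>strict_index_lists (length ?gs) N. \<Prod>j<length ?gs. (?gs ! j) (ns ! j))"
    by (simp add: alt_mzv_partial_def)
  also have "\<dots> = (\<Sum>n\<le>N. foldr mzv_step ss unit_seq n)"
    unfolding sum_strict_index_lists by (simp add: foldr_map comp_def mzv_step_def[abs_def])
  finally show ?thesis .
qed

lemma mzv_step_1: "mzv_step 1 = primitive X1"
  by (simp add: mzv_step_def fun_eq_iff)

text \<open>The weight 1/n^2 is split into 1/n times 1/n: an entry 2 is the word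
  \<open>x0 x1\<close>.\<close>

lemma mzv_step_2: "mzv_step 2 s = primitive X0 (primitive X1 s)"
  by (simp add: mzv_step_def nest_def fun_eq_iff power2_eq_square)

lemma foldr_mzv_step_blocks:
  "foldr mzv_step (concat (map (\<lambda>i. replicate (p i) 1 @ [2]) is)) s =
   foldr primitive (concat (map (\<lambda>i. replicate (p i) X1 @ [X0, X1]) is)) s"
  by (induction "is") (simp_all add: mzv_step_1 mzv_step_2 del: primitive.simps)

text \<open>The trailing \<open>x1\<close> of each entry 2 is regrouped with the following block,
  and the \<open>x1\<close> of the leading entry completes the first one; this turns the lengths
  \<open>m i - 1\<close> into \<open>m i\<close>.\<close>

lemma shift_blocks:
  assumes "\<And>i. i \<in> set is \<Longrightarrow> m i \<ge> (1::nat)"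
  shows "x # concat (map (\<lambda>i. replicate (m i - 1) x @ [y, x]) is) @ r =
         concat (map (\<lambda>i. replicate (m i) x @ [y]) is) @ x # r"
  using assms
proof (induction "is")
  case (Cons i "is")
  then have "replicate (m i) x = x # replicate (m i - 1) x"
    using Cons.prems[of i] by (cases "m i") auto
  with Cons show ?case by simp
qed simp

section \<open>Reversal of words, which renumbers block i as k + 1 - i\<close>

lemma rev_upt_1: "rev [Suc 0..<Suc k] = map (\<lambda>i. Suc k - i) [Suc 0..<Suc k]"
  by (rule nth_equalityI) (auto simp: rev_nth simp del: upt_Suc)

lemma rev_word:
  "rev (concat (map (\<lambda>i. replicate (m i) X1 @ [X0]) [1..<k+1]) @ replicate q X1) =
   replicate q X1 @ concat (map (\<lambda>i. X0 # replicate (m (k+1-i)) X1) [1..<k+1])"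
  by (simp add: rev_concat rev_map rev_upt_1 comp_def del: upt_Suc)

theorem theorem4p1:
  fixes k M :: nat and m :: "nat \<Rightarrow> nat"
  assumes "k \<ge> 1"
    and "\<And>i. i \<in> {1..k+1} \<Longrightarrow> m i \<ge> 1"
    and "M = (\<Sum>i=1..k+1. m i)"
  shows "complex_of_real (alt_mzv
           ([-1] @ concat (map (\<lambda>i. replicate (m i - 1) 1 @ [2]) [1..<k+1])
             @ replicate (m (k+1) - 1) 1))
       = (\<Sum>\<sigma>\<in>{1..k} \<rightarrow>\<^sub>E {-1, 1}.
           multi_polylog (replicate (M + k) 1)
             ([-1] @ replicate (m (k+1) - 1) 1
               @ concat (map (\<lambda>i. [\<sigma> i, \<sigma> i] @ replicate (m (k+1-i) - 1) 1) [1..<k+1]))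
           / ((-1) ^ k * (\<Prod>i=1..k. \<sigma> i)))"
proof -
  define q where "q = m (k+1)"
  have q: "q \<ge> 1" and m: "\<And>i. i \<in> {1..k} \<Longrightarrow> m i \<ge> 1"
    using assms(2) by (auto simp: q_def)
  have rep_q: "replicate q X1 = X1 # replicate (q - 1) X1"
    using q by (cases q) auto
  define ss where "ss = [-1] @ concat (map (\<lambda>i. replicate (m i - 1) 1 @ [2 :: int]) [1..<k+1])
             @ replicate (q - 1) 1"
  define w where "w = concat (map (\<lambda>i. replicate (m i) X1 @ [X0]) [1..<k+1]) @ replicate q X1"
  have w_shift: "w = X1 # concat (map (\<lambda>i. replicate (m i - 1) X1 @ [X0, X1]) [1..<k+1])
      @ replicate (q - 1) X1"
    unfolding w_def rep_q using m by (intro shift_blocks[symmetric]) auto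
  \<comment> \<open>The leading entry -1 is an ordinary \<open>x1\<close> step with the sign
    \<open>(-1) ^ n\<close>, that is, evaluation at -1.\<close>
  have step: "foldr mzv_step ss unit_seq = (\<lambda>n. (-1) ^ n * foldr primitive w unit_seq n)"
    unfolding w_shift ss_def foldr_append comp_def foldr_mzv_step_blocks foldr_replicate mzv_step_1
    by (simp add: mzv_step_def nest_def fun_eq_iff del: upt_Suc)
  have w: "w \<noteq> []" "hd w = X1" "last w = X1"
    using q by (simp_all add: w_shift)
  have "foldr mzv_step ss unit_seq sums (\<Sum>n. (-1) ^ n * fold dual_primitive w unit_seq n)"
    unfolding step duality(3)[OF w, symmetric] by (rule summable_sums[OF duality(1)[OF w]])
  then have "alt_mzv_partial ss \<longlonglongrightarrow> (\<Sum>n. (-1) ^ n * fold dual_primitive w unit_seq n)"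
    by (simp add: alt_mzv_partial_eq[abs_def] sums_def_le)
  then have mzv: "alt_mzv ss = (\<Sum>n. (-1) ^ n * fold dual_primitive w unit_seq n)"
    by (simp add: alt_mzv_def limI)

  define w' where "w' = replicate q X1 @ concat (map (\<lambda>i. X0 # replicate (m (k+1-i)) X1) [1..<k+1])"
  have "fold dual_primitive w unit_seq n = (foldr dual_primitive w' unit_seq n :: real)" for n
    unfolding w'_def rev_word[symmetric] w_def[symmetric] by (simp add: foldr_conv_fold)
  then have "(\<lambda>n. (-1) ^ n * foldr dual_primitive w' unit_seq n) sums alt_mzv ss"
    using duality(2)[OF w] by (simp add: mzv summable_sums)
  then have "(\<lambda>n. complex_of_real ((-1) ^ n * foldr dual_primitive w' unit_seq n))
      sums complex_of_real (alt_mzv ss)"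
    by (rule sums_of_real)
  then have sums1: "(\<lambda>n. (-1) ^ n * foldr dual_primitive w' unit_seq n) sums complex_of_real (alt_mzv ss)"
    by (simp add: of_real_foldr_dual_primitive)

  define Z where "Z \<sigma> = concat (map (\<lambda>i. [\<sigma> i, \<sigma> i] @ replicate (m (k+1-i) - 1) 1) [1..<k+1])"
    for \<sigma> :: "nat \<Rightarrow> complex"
  define zs where "zs \<sigma> = replicate (q - 1) 1 @ Z \<sigma>" for \<sigma>
  \<comment> \<open>Each block has 2 + (m - 1) = m + 1 arguments; the leading -1 and the q - 1 ones
    make up \<open>q\<close>.\<close>
  have len: "length (zs \<sigma>) + 1 = M + k" for \<sigma>
  proof -
    have "length (Z \<sigma>) = (\<Sum>i\<leftarrow>[1..<k+1]. 2 + (m (k+1-i) - 1))"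
      by (simp add: Z_def length_concat comp_def del: upt_Suc)
    also have "\<dots> = (\<Sum>i=1..k. 2 + (m (k+1-i) - 1))"
      by (simp add: sum_list_distinct_conv_sum_set atLeastLessThanSuc_atLeastAtMost del: upt_Suc)
    also have "\<dots> = (\<Sum>i=1..k. 2 + (m i - 1))"
      by (rule sum.reindex_bij_witness[of _ "\<lambda>i. k+1-i" "\<lambda>i. k+1-i"]) auto
    also have "\<dots> = (\<Sum>i=1..k. m i + 1)"
    proof (rule sum.cong[OF refl])
      show "2 + (m i - 1) = m i + 1" if "i \<in> {1..k}" for i
        using m[OF that] by simp
    qed
    also have "\<dots> = (\<Sum>i=1..k. m i) + k"
      by (simp only: sum.distrib) simp
    finally show ?thesis
      using q assms(3) by (simp add: zs_def q_def)
  qed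
  have sums2: "(\<lambda>n. \<Sum>\<sigma>\<in>{1..k} \<rightarrow>\<^sub>E {-1, 1}. (\<Prod>i=1..k. - \<sigma> i) * foldr polylog_step (-1 # zs \<sigma>) unit_seq n)
      sums (\<Sum>\<sigma>\<in>{1..k} \<rightarrow>\<^sub>E {-1, 1}. (\<Prod>i=1..k. - \<sigma> i) * multi_polylog (replicate (M + k) 1) (-1 # zs \<sigma>))"
  proof (intro sums_sum sums_mult multi_polylog_ones_sums len)
    fix \<sigma> and y :: complex
    assume \<sigma>: "\<sigma> \<in> {1..k} \<rightarrow>\<^sub>E {-1, 1}" and y: "y \<in> set (zs \<sigma>)"
    from y consider "y = 1" | i where "i \<in> {1..k}" "y = \<sigma> i"
      unfolding zs_def Z_def by (auto simp: less_Suc_eq_le simp del: upt_Suc split: if_splits)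
    then show "norm y = 1"
    proof cases
      case (2 i)
      then show ?thesis using PiE_mem[OF \<sigma>, of i] by auto
    qed simp
  qed
  \<comment> \<open>The two sides already agree term by term in the outermost index.\<close>
  have coeff: "(\<Sum>\<sigma>\<in>{1..k} \<rightarrow>\<^sub>E {-1, 1}. (\<Prod>i=1..k. - \<sigma> i) * foldr polylog_step (-1 # zs \<sigma>) unit_seq n) =
      (-1) ^ n * foldr dual_primitive w' unit_seq n" for n
  proof -
    have "(\<Sum>\<sigma>\<in>{1..k} \<rightarrow>\<^sub>E {-1, 1}. (\<Prod>i=1..k. - \<sigma> i) * foldr polylog_step (-1 # zs \<sigma>) unit_seq n) =
        foldr polylog_step (-1 # replicate (q - 1) 1)
          (\<lambda>n. \<Sum>\<sigma>\<in>{1..k} \<rightarrow>\<^sub>E {-1, 1}. (\<Prod>i=1..k. - \<sigma> i) * foldr polylog_step (Z \<sigma>) unit_seq n) n"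
      unfolding foldr_polylog_step_linear
      by (simp only: zs_def foldr_append foldr.simps comp_apply)
    also have "(\<lambda>n. \<Sum>\<sigma>\<in>{1..k} \<rightarrow>\<^sub>E {-1, 1}. (\<Prod>i=1..k. - \<sigma> i) * foldr polylog_step (Z \<sigma>) unit_seq n) =
        foldr dual_primitive (concat (map (\<lambda>i. X0 # replicate (m (k+1-i)) X1) [1..<k+1])) unit_seq"
      unfolding Z_def by (intro ext sum_signs_polylog m) auto
    finally show ?thesis
      by (simp add: w'_def rep_q polylog_step_minus_1 polylog_step_1
          del: upt_Suc dual_primitive.simps)
  qed
  have "complex_of_real (alt_mzv ss) =
      (\<Sum>\<sigma>\<in>{1..k} \<rightarrow>\<^sub>E {-1, 1}. (\<Prod>i=1..k. - \<sigma> i) * multi_polylog (replicate (M + k) 1) (-1 # zs \<sigma>))"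
    using sums_unique2[OF sums1 sums2[unfolded coeff]] .
  also have "\<dots> = (\<Sum>\<sigma>\<in>{1..k} \<rightarrow>\<^sub>E {-1, 1}. multi_polylog (replicate (M + k) 1) (-1 # zs \<sigma>)
      / ((-1) ^ k * (\<Prod>i=1..k. \<sigma> i)))"
  proof (rule sum.cong[OF refl])
    fix \<sigma> :: "nat \<Rightarrow> complex" assume \<sigma>: "\<sigma> \<in> {1..k} \<rightarrow>\<^sub>E {-1, 1}"
    \<comment> \<open>Signs are their own inverses, so multiplying by the partial fraction
      coefficients is the division in the claim.\<close>
    have "(\<Prod>i=1..k. - \<sigma> i) = (\<Prod>i=1..k. inverse (- \<sigma> i))"
    proof (rule prod.cong[OF refl])
      show "- \<sigma> i = inverse (- \<sigma> i)" if "i \<in> {1..k}" for i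
        using PiE_mem[OF \<sigma> that] by auto
    qed
    also have "\<dots> = inverse (\<Prod>i=1..k. - \<sigma> i)"
      using prod_inversef[of "\<lambda>i. - \<sigma> i" "{1..k}"] by (simp only: comp_def)
    also have "\<dots> = inverse ((-1) ^ k * (\<Prod>i=1..k. \<sigma> i))"
      by (simp add: prod_uminus)
    finally show "(\<Prod>i=1..k. - \<sigma> i) * multi_polylog (replicate (M + k) 1) (-1 # zs \<sigma>) =
        multi_polylog (replicate (M + k) 1) (-1 # zs \<sigma>) / ((-1) ^ k * (\<Prod>i=1..k. \<sigma> i))"
      by (simp add: divide_inverse mult.commute)
  qed
  finally show ?thesis
    by (simp only: ss_def zs_def Z_def q_def append_Cons append_Nil)
qed

end
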